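(* Let $T$ be a tree on $n$ vertices that has a perfect matching and has diameter $D\geq 5$. Let $P=v_0v_1\ldots v_D$ be a diametric path in $T$ and let $w_1,\ldots,w_k$ be all vertices in $V(T)\setminus\{v_3\}$ that are adjacent to $v_2$ and have degree $2$. Let $T'$ be the tree obtained from $T$ by deleting the edges $v_2w_1,\ldots,v_2w_k$ and adding the edges $v_3w_1,\ldots,v_3w_k$. Then $T'$ is a tree on $n$ vertices which has a perfect matching, and $\xi^{ac}(T)<\xi^{ac}(T')$.
   Context: A matching is a set of edges no two sharing a vertex; it is perfect if every vertex is incident to an edge of it. $d(u,v)$ is the distance, $\varepsilon(u)=\max_v d(u,v)$ the eccentricity, the diameter $D$ the maximum distance, and a path $v_0\ldots v_D$ with $d(v_0,v_D)=D$ is diametric. $M(u)$ is the product of the degrees of all neighbors of $u$, and $\xi^{ac}(G)=\sum_{u\in V(G)}\frac{M(u)}{\varepsilon(u)}$. *)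

theory Defs
  imports Complex_Main
begin

record 'a sgraph =
  verts :: "'a set"
  edges :: "'a set set"

definition simple_graph :: "'a sgraph \<Rightarrow> bool" where
  "simple_graph G \<longleftrightarrow> finite (verts G) \<and>
     (\<forall>e\<in>edges G. \<exists>u\<in>verts G. \<exists>v\<in>verts G. u \<noteq> v \<and> e = {u, v})"

definition neighbors :: "'a sgraph \<Rightarrow> 'a \<Rightarrow> 'a set" where
  "neighbors G u = {v \<in> verts G. {u, v} \<in> edges G}"

definition degree :: "'a sgraph \<Rightarrow> 'a \<Rightarrow> nat" where
  "degree G u = card (neighbors G u)"

definition is_walk :: "'a sgraph \<Rightarrow> 'a list \<Rightarrow> bool" where
  "is_walk G p \<longleftrightarrow> p \<noteq> [] \<and> set p \<subseteq> verts G \<and>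
     (\<forall>i. Suc i < length p \<longrightarrow> {p ! i, p ! Suc i} \<in> edges G)"

definition is_path :: "'a sgraph \<Rightarrow> 'a list \<Rightarrow> bool" where
  "is_path G p \<longleftrightarrow> is_walk G p \<and> distinct p"

text \<open>A cycle is listed without repeating its first vertex at the end.\<close>

definition is_cycle :: "'a sgraph \<Rightarrow> 'a list \<Rightarrow> bool" where
  "is_cycle G p \<longleftrightarrow> is_path G p \<and> length p \<ge> 3 \<and> {last p, hd p} \<in> edges G"

definition is_connected :: "'a sgraph \<Rightarrow> bool" where
  "is_connected G \<longleftrightarrow> verts G \<noteq> {} \<and>
     (\<forall>u\<in>verts G. \<forall>v\<in>verts G. \<exists>p. is_path G p \<and> hd p = u \<and> last p = v)"

definition is_tree :: "'a sgraph \<Rightarrow> bool" where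
  "is_tree G \<longleftrightarrow> simple_graph G \<and> is_connected G \<and> (\<nexists>p. is_cycle G p)"

definition is_matching :: "'a sgraph \<Rightarrow> 'a set set \<Rightarrow> bool" where
  "is_matching G M \<longleftrightarrow> M \<subseteq> edges G \<and> (\<forall>e\<in>M. \<forall>f\<in>M. e \<noteq> f \<longrightarrow> e \<inter> f = {})"

definition is_perfect_matching :: "'a sgraph \<Rightarrow> 'a set set \<Rightarrow> bool" where
  "is_perfect_matching G M \<longleftrightarrow> is_matching G M \<and> (\<forall>u\<in>verts G. \<exists>e\<in>M. u \<in> e)"

definition has_perfect_matching :: "'a sgraph \<Rightarrow> bool" where
  "has_perfect_matching G \<longleftrightarrow> (\<exists>M. is_perfect_matching G M)"

text \<open>The length of a path is its number of edges, one less than its number of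
  vertices. The value is meaningful only if some path joins the two vertices.\<close>

definition gdist :: "'a sgraph \<Rightarrow> 'a \<Rightarrow> 'a \<Rightarrow> nat" where
  "gdist G u v = (LEAST l. \<exists>p. is_path G p \<and> hd p = u \<and> last p = v \<and> length p = l + 1)"

definition eccentricity :: "'a sgraph \<Rightarrow> 'a \<Rightarrow> nat" where
  "eccentricity G u = Max {gdist G u v | v. v \<in> verts G}"

definition diam :: "'a sgraph \<Rightarrow> nat" where
  "diam G = Max {gdist G u v | u v. u \<in> verts G \<and> v \<in> verts G}"

text \<open>A path \<open>v\<^sub>0 \<dots> v\<^sub>D\<close>, with \<open>D\<close> the diameter, is the list \<open>p\<close> with \<open>p ! i = v\<^sub>i\<close>.\<close>

definition is_diametric_path :: "'a sgraph \<Rightarrow> 'a list \<Rightarrow> bool" where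
  "is_diametric_path G p \<longleftrightarrow>
     is_path G p \<and> length p = diam G + 1 \<and> gdist G (p ! 0) (p ! diam G) = diam G"

definition neighbor_degree_prod :: "'a sgraph \<Rightarrow> 'a \<Rightarrow> nat" where
  "neighbor_degree_prod G u = (\<Prod>v\<in>neighbors G u. degree G v)"

definition xi_ac :: "'a sgraph \<Rightarrow> real" where
  "xi_ac G = (\<Sum>u\<in>verts G. real (neighbor_degree_prod G u) / real (eccentricity G u))"

end

theory Submission
  imports Defs
begin

text \<open>
  Since \<open>P\<close> is diametric, the side of \<open>v2\<close> in \<open>T - v2v3\<close> has depth at most two below \<open>v2\<close>; the perfect
  matching then forces it to consist of \<open>v2\<close>, the \<open>k\<close> vertices \<open>w\<^sub>i\<close> with one leaf each, and \<open>l \<le> 1\<close>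
  leaves adjacent to \<open>v2\<close>. Moving the branches brings \<open>v3\<close> within distance \<open>D - 3\<close> of every vertex,
  and no eccentricity grows. The product \<open>M\<close> decreases only at \<open>v2\<close>, by \<open>2\<^sup>k b - b - k\<close> with
  \<open>b = deg v3\<close>, and at the leaf next to \<open>v2\<close>, by \<open>k\<close>. This is compensated by \<open>v3\<close>, which gains
  \<open>R ((l + 1) 2\<^sup>k - (k + l + 1))\<close> where \<open>R\<close> is the product of the degrees of its other neighbours and
  \<open>(l + 1) R \<ge> 2 ^ (b - 1) \<ge> b\<close> by the matching, and by the \<open>b - 1\<close> other neighbours of \<open>v3\<close>, each gaining at
  least \<open>k\<close>; the gains count with weight at least, the losses at most, \<open>1 / (D - 2)\<close>. The inequality is strict at \<open>v1\<close>, whose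
  eccentricity drops.
\<close>

section \<open>Walks and distances in trees\<close>

lemma simple_graph_edgeD:
  assumes "simple_graph G" "{u, v} \<in> edges G"
  shows "u \<in> verts G" "v \<in> verts G" "u \<noteq> v"
  using assms unfolding simple_graph_def by (fastforce simp: doubleton_eq_iff)+

lemma edge_sym: "{u, v} \<in> E \<Longrightarrow> {v, u} \<in> E"
  by (simp add: insert_commute)

lemma neighbors_iff:
  assumes "simple_graph G"
  shows "v \<in> neighbors G u \<longleftrightarrow> {u, v} \<in> edges G"
  using simple_graph_edgeD[OF assms] by (auto simp: neighbors_def)

lemma finite_neighbors: "simple_graph G \<Longrightarrow> finite (neighbors G u)"
  by (auto simp: neighbors_def simple_graph_def)

lemma is_walk_Cons_Cons:
  "is_walk G (a # b # p) \<longleftrightarrow> a \<in> verts G \<and> {a, b} \<in> edges G \<and> is_walk G (b # p)"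
  unfolding is_walk_def by (auto simp: nth_Cons split: nat.splits)

lemma is_walk_single: "is_walk G [a] \<longleftrightarrow> a \<in> verts G"
  by (auto simp: is_walk_def)

lemma is_walk_take: "is_walk G p \<Longrightarrow> 0 < n \<Longrightarrow> is_walk G (take n p)"
  by (auto simp: is_walk_def dest: in_set_takeD)

lemma is_walk_tl: "is_walk G p \<Longrightarrow> tl p \<noteq> [] \<Longrightarrow> is_walk G (tl p)"
  by (cases p; cases "tl p") (auto simp: is_walk_Cons_Cons)

lemma is_walk_snoc:
  "is_walk G p \<Longrightarrow> {last p, w} \<in> edges G \<Longrightarrow> w \<in> verts G \<Longrightarrow> is_walk G (p @ [w])"
proof (induction p)
  case Nil then show ?case by (simp add: is_walk_def)
next
  case (Cons a p)
  then show ?case by (cases p) (auto simp: is_walk_Cons_Cons is_walk_single)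
qed

text \<open>A local condition, comparing only vertices two positions apart: it is easy to check on
  glued walks, and in an acyclic graph it already forces all vertices to be distinct.\<close>

fun nonbacktracking :: "'a list \<Rightarrow> bool" where
  "nonbacktracking (a # b # c # p) \<longleftrightarrow> a \<noteq> c \<and> nonbacktracking (b # c # p)"
| "nonbacktracking _ \<longleftrightarrow> True"

lemma nonbacktracking_distinct: "distinct p \<Longrightarrow> nonbacktracking p"
  by (induction p rule: nonbacktracking.induct) auto

text \<open>Induction from the front. If \<open>a\<close> reappeared in the path
  \<open>b # c # p\<close>, the segment from \<open>b\<close> to that occurrence would be closed by
  the edge \<open>{a, b}\<close> into a cycle.\<close>

lemma nonbacktracking_is_path:
  assumes "simple_graph G" "\<nexists>c. is_cycle G c" "is_walk G p" "nonbacktracking p"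
  shows "is_path G p"
  using assms(3,4)
proof (induction p rule: nonbacktracking.induct)
  case (1 a b c p)
  let ?q = "b # c # p"
  have w: "is_walk G ?q" and ab: "{a, b} \<in> edges G" and ac: "a \<noteq> c"
    using 1 by (auto simp: is_walk_Cons_Cons)
  then have q: "is_path G ?q" using 1 by auto
  have "a \<notin> set ?q"
  proof
    assume "a \<in> set ?q"
    then obtain j where j: "j < length ?q" "?q ! j = a" by (meson in_set_conv_nth)
    \<comment> \<open>Position 0 would make \<open>{a, b}\<close> a loop and position 1 would be a
      backtrack, so the segment has at least three vertices.\<close>
    have "j \<noteq> 0" using j simple_graph_edgeD(3)[OF assms(1) ab] by (cases j) auto
    moreover have "j \<noteq> 1" using j ac by auto
    ultimately have j2: "j \<ge> 2" by simp
    let ?c = "take (Suc j) ?q"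
    have "is_path G ?c" using q is_walk_take[of G ?q "Suc j"] distinct_take[of ?q "Suc j"]
      by (simp only: is_path_def)
    moreover have "last ?c = a" using j by (subst take_Suc_conv_app_nth) auto
    moreover have "hd ?c = b" by simp
    moreover have "length ?c \<ge> 3" using j2 j by (simp add: min_def)
    ultimately have "is_cycle G ?c" using ab by (simp only: is_cycle_def)
    then show False using assms(2) by blast
  qed
  then show ?case using q 1 by (simp add: is_path_def)
next
  case ("2_1")
  then show ?case by (simp add: is_path_def)
next
  case ("2_2" a)
  then show ?case by (simp add: is_path_def)
next
  case ("2_3" a b)
  then show ?case using simple_graph_edgeD(3)[OF assms(1)]
    by (auto simp: is_path_def is_walk_Cons_Cons)
qed

lemma is_walk_glue:
  "is_walk G (u # p) \<Longrightarrow> is_walk G (u # q) \<Longrightarrow> is_walk G (rev p @ u # q)"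
proof (induction p arbitrary: u q)
  case (Cons a p)
  then have "is_walk G (a # u # q)" "is_walk G (a # p)"
    using is_walk_tl[of G "u # a # p"] by (auto simp: is_walk_Cons_Cons insert_commute)
       (auto simp: is_walk_def)
  from Cons.IH[OF this(2,1)] show ?case by simp
qed simp

text \<open>Only the triple centred at \<open>u\<close> is new, whence the condition on the
  heads.\<close>

lemma nonbacktracking_glue:
  "nonbacktracking (u # p) \<Longrightarrow> nonbacktracking (u # q) \<Longrightarrow>
    (p \<noteq> [] \<Longrightarrow> q \<noteq> [] \<Longrightarrow> hd p \<noteq> hd q) \<Longrightarrow> nonbacktracking (rev p @ u # q)"
proof (induction p arbitrary: u q)
  case (Cons a p)
  have "nonbacktracking (a # u # q)" using Cons.prems by (cases q) auto
  moreover have "nonbacktracking (a # p)" using Cons.prems by (cases p) auto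
  moreover have "p \<noteq> [] \<Longrightarrow> hd p \<noteq> hd (u # q)" using Cons.prems by (cases p) auto
  ultimately show ?case using Cons.IH[of a "u # q"] by simp
qed simp

text \<open>Equal first steps are stripped by induction. Where the paths diverge, reversing one and
  appending the other gives a nonbacktracking walk, hence a path, which would contain the common
  last vertex twice.\<close>

lemma unique_path:
  assumes "simple_graph G" "\<nexists>c. is_cycle G c"
  shows "is_path G p \<Longrightarrow> is_path G q \<Longrightarrow> hd p = hd q \<Longrightarrow> last p = last q \<Longrightarrow> p = q"
proof (induction p arbitrary: q)
  case Nil
  then show ?case by (simp add: is_path_def is_walk_def)
next
  case (Cons u p)
  then obtain q' where q: "q = u # q'" by (cases q) (auto simp: is_path_def is_walk_def)
  show ?case
  proof (cases "p = [] \<or> q' = []")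
    case True
    then show ?thesis using Cons.prems q by (auto simp: is_path_def split: if_splits)
  next
    case False
    show ?thesis
    proof (cases "hd p = hd q'")
      case True
      have "is_path G p" "is_path G q'"
        using Cons.prems False q is_walk_tl[of G "u # p"] is_walk_tl[of G "u # q'"]
        by (auto simp: is_path_def)
      then show ?thesis using Cons.IH[of q'] Cons.prems True False q by auto
    next
      case ne: False
      have "is_path G (rev p @ u # q')"
        using Cons.prems q ne
        by (intro nonbacktracking_is_path[OF assms] is_walk_glue nonbacktracking_glue)
          (auto simp: is_path_def intro: nonbacktracking_distinct)
      moreover have "last p \<in> set p" "last q' \<in> set q'" "last p = last q'"
        using False Cons.prems q last_in_set[of p] last_in_set[of q'] by (auto simp del: last_in_set)
      ultimately show ?thesis by (auto simp: is_path_def)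
    qed
  qed
qed

text \<open>Only length and end points are recorded, so walks can be concatenated, reversed and
  transferred between graphs without list manipulation.\<close>

inductive walk_len :: "'a sgraph \<Rightarrow> nat \<Rightarrow> 'a \<Rightarrow> 'a \<Rightarrow> bool" for G where
  refl: "u \<in> verts G \<Longrightarrow> walk_len G 0 u u"
| step: "walk_len G n u v \<Longrightarrow> {v, w} \<in> edges G \<Longrightarrow> w \<in> verts G \<Longrightarrow> walk_len G (Suc n) u w"

lemma walk_len_verts: "walk_len G n u v \<Longrightarrow> u \<in> verts G \<and> v \<in> verts G"
  by (induction rule: walk_len.induct) auto

lemma walk_len_trans: "walk_len G n v w \<Longrightarrow> walk_len G m u v \<Longrightarrow> walk_len G (m + n) u w"
  by (induction rule: walk_len.induct) (auto intro: walk_len.intros)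

lemma walk_len_edge:
  "simple_graph G \<Longrightarrow> {u, v} \<in> edges G \<Longrightarrow> walk_len G 1 u v"
  using walk_len.step[OF walk_len.refl, of u G v] simple_graph_edgeD[of G u v] by auto

lemma walk_len_sym: "walk_len G n u v \<Longrightarrow> walk_len G n v u"
proof (induction rule: walk_len.induct)
  case (step n u v w)
  have "walk_len G 1 w v"
    using walk_len.step[OF walk_len.refl, of w G v] step walk_len_verts[OF step(1)]
    by (simp add: insert_commute)
  from walk_len_trans[OF step.IH this] show ?case by simp
qed (rule walk_len.refl)

lemma walk_len_mono:
  assumes "walk_len G n u v" "verts G \<subseteq> verts G'" "edges G \<subseteq> edges G'"
  shows "walk_len G' n u v"
  using assms by (induction rule: walk_len.induct) (auto intro: walk_len.intros)

lemma is_walk_walk_len: "is_walk G p \<Longrightarrow> walk_len G (length p - 1) (hd p) (last p)"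
proof (induction p rule: induct_list012)
  case (3 a b p)
  then have "walk_len G (length p) b (last (b # p))" by (auto simp: is_walk_Cons_Cons)
  moreover have "walk_len G 1 a b"
    using 3 walk_len.step[OF walk_len.refl, of a G b] by (auto simp: is_walk_def)
  ultimately show ?case using walk_len_trans by fastforce
qed (auto simp: is_walk_def intro: walk_len.refl)

text \<open>Induction on the walk: if the new vertex \<open>w\<close> already lies on the path, the
  path is truncated at \<open>w\<close>; otherwise it is extended by \<open>w\<close>.\<close>

lemma walk_len_path:
  "walk_len G n u v \<Longrightarrow> \<exists>p. is_path G p \<and> hd p = u \<and> last p = v \<and> length p \<le> n + 1"
proof (induction rule: walk_len.induct)
  case (refl u)
  then show ?case by (intro exI[of _ "[u]"]) (auto simp: is_path_def is_walk_def)
next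
  case (step n u v w)
  then obtain p where p: "is_path G p" "hd p = u" "last p = v" "length p \<le> n + 1" by blast
  have ne: "p \<noteq> []" using p by (auto simp: is_path_def is_walk_def)
  show ?case
  proof (cases "w \<in> set p")
    case True
    then obtain j where j: "j < length p" "p ! j = w" by (meson in_set_conv_nth)
    then have "last (take (Suc j) p) = w" by (subst take_Suc_conv_app_nth) auto
    moreover have "is_path G (take (Suc j) p)"
      using p is_walk_take[of G p "Suc j"] by (auto simp: is_path_def)
    ultimately show ?thesis using p ne j by (intro exI[of _ "take (Suc j) p"]) auto
  next
    case False
    then show ?thesis using p ne step is_walk_snoc[of G p w]
      by (intro exI[of _ "p @ [w]"]) (auto simp: is_path_def)
  qed
qed

lemma is_connectedI:
  assumes "a \<in> verts G" "\<And>v. v \<in> verts G \<Longrightarrow> \<exists>n. walk_len G n a v"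
  shows "is_connected G"
proof -
  have "\<exists>n. walk_len G n u v" if "u \<in> verts G" "v \<in> verts G" for u v
    using assms(2) that walk_len_trans walk_len_sym by metis
  then show ?thesis using assms(1) walk_len_path unfolding is_connected_def by (metis empty_iff)
qed

lemma gdist_le:
  assumes "walk_len G n u v"
  shows "gdist G u v \<le> n"
proof -
  obtain p where p: "is_path G p" "hd p = u" "last p = v" "length p \<le> n + 1"
    using walk_len_path[OF assms] by blast
  have "length p = (length p - 1) + 1" using p by (cases p) (auto simp: is_path_def is_walk_def)
  then have "gdist G u v \<le> length p - 1"
    unfolding gdist_def using p by (intro Least_le exI[of _ p] conjI)
  then show ?thesis using p by simp
qed

text \<open>Connectedness supplies a candidate for the \<open>LEAST\<close>, so the minimum is
  attained.\<close>

lemma gdist_path: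
  assumes "is_connected G" "u \<in> verts G" "v \<in> verts G"
  obtains p where "is_path G p" "hd p = u" "last p = v" "length p = gdist G u v + 1"
proof -
  obtain q where q: "is_path G q" "hd q = u" "last q = v"
    using assms unfolding is_connected_def by blast
  then have "length q = (length q - 1) + 1" by (cases q) (auto simp: is_path_def is_walk_def)
  with q have "\<exists>l p. is_path G p \<and> hd p = u \<and> last p = v \<and> length p = l + 1" by blast
  from LeastI_ex[OF this] that show ?thesis unfolding gdist_def by blast
qed

lemma walk_len_gdist:
  assumes "is_connected G" "u \<in> verts G" "v \<in> verts G"
  shows "walk_len G (gdist G u v) u v"
  using gdist_path[OF assms] is_walk_walk_len unfolding is_path_def by (metis add_diff_cancel_right')

lemma eccentricity_ge:
  "finite (verts G) \<Longrightarrow> v \<in> verts G \<Longrightarrow> gdist G u v \<le> eccentricity G u"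
  unfolding eccentricity_def by (intro Max_ge) auto

lemma eccentricity_le:
  assumes "finite (verts G)" "verts G \<noteq> {}"
    and "\<And>v. v \<in> verts G \<Longrightarrow> \<exists>k\<le>n. walk_len G k u v"
  shows "eccentricity G u \<le> n"
proof -
  have "gdist G u v \<le> n" if "v \<in> verts G" for v
    using assms(3)[OF that] by (auto dest!: gdist_le)
  then show ?thesis unfolding eccentricity_def using assms(1,2) by (subst Max_le_iff) auto
qed

lemma eccentricity_pos:
  assumes "finite (verts G)" "is_connected G" "u \<in> verts G" "v \<in> verts G" "u \<noteq> v"
  shows "0 < eccentricity G u"
proof -
  have "gdist G u v \<noteq> 0"
    using walk_len_gdist[OF assms(2-4)] assms(5) by (auto elim: walk_len.cases)
  then show ?thesis using eccentricity_ge[OF assms(1,4), of u] by linarith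
qed

lemma gdist_le_diam:
  assumes "finite (verts G)" "u \<in> verts G" "v \<in> verts G"
  shows "gdist G u v \<le> diam G"
proof -
  have "{gdist G u v | u v. u \<in> verts G \<and> v \<in> verts G}
      = (\<lambda>(u, v). gdist G u v) ` (verts G \<times> verts G)" by auto
  then show ?thesis unfolding diam_def using assms by (intro Max_ge) auto
qed

text \<open>A shortest path has the same end points, so by uniqueness it is \<open>p\<close>
  itself.\<close>

lemma tree_path_gdist:
  assumes "is_tree G" "is_path G p"
  shows "gdist G (hd p) (last p) + 1 = length p"
proof -
  have "hd p \<in> verts G" "last p \<in> verts G"
    using assms(2) by (auto simp: is_path_def is_walk_def)
  then obtain q where "is_path G q" "hd q = hd p" "last q = last p"
    "length q = gdist G (hd p) (last p) + 1"
    using gdist_path assms(1) unfolding is_tree_def by metis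
  then show ?thesis using unique_path[of G p q] assms by (auto simp: is_tree_def)
qed

text \<open>Such a walk is a path and its length a distance. In this form the maximality of
  \<open>D\<close> limits the branches at \<open>v2\<close>.\<close>

lemma tree_nonbacktracking_length:
  assumes "is_tree G" "is_walk G p" "nonbacktracking p"
  shows "length p \<le> diam G + 1"
proof -
  have p: "is_path G p" using assms nonbacktracking_is_path[of G p] by (auto simp: is_tree_def)
  have "hd p \<in> verts G" "last p \<in> verts G" "finite (verts G)"
    using assms by (auto simp: is_walk_def is_tree_def simple_graph_def)
  then show ?thesis using tree_path_gdist[OF assms(1) p] gdist_le_diam by fastforce
qed

lemma tree_nonbacktracking_distinct:
  "is_tree G \<Longrightarrow> is_walk G p \<Longrightarrow> nonbacktracking p \<Longrightarrow> distinct p"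
  using nonbacktracking_is_path[of G p] by (auto simp: is_tree_def is_path_def)

lemma cycle_two_neighbors:
  assumes "is_cycle G c" "v \<in> set c"
  obtains a b where "a \<in> set c" "b \<in> set c" "a \<noteq> b" "{v, a} \<in> edges G" "{v, b} \<in> edges G"
proof -
  have c: "distinct c" "length c \<ge> 3" "{last c, hd c} \<in> edges G"
    and e: "\<And>i. Suc i < length c \<Longrightarrow> {c ! i, c ! Suc i} \<in> edges G"
    using assms(1) by (auto simp: is_cycle_def is_path_def is_walk_def)
  have ne: "c \<noteq> []" using c by auto
  obtain i where i: "i < length c" "c ! i = v" using assms(2) by (meson in_set_conv_nth)
  define l where "l = length c"
  have cl: "{c ! (l - 1), c ! 0} \<in> edges G" using c ne by (simp add: last_conv_nth hd_conv_nth l_def)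
  \<comment> \<open>\<open>j\<close> and \<open>k\<close> are the cyclic predecessor and successor
    of \<open>i\<close>; they differ because a cycle has at least three vertices.\<close>
  define j where "j = (if i = 0 then l - 1 else i - 1)"
  define k where "k = (if Suc i = l then 0 else Suc i)"
  have jk: "j < length c" "k < length c" "j \<noteq> k"
    using i c by (auto simp: j_def k_def l_def)
  have "{v, c ! j} \<in> edges G"
    using i cl e[of "i - 1"] by (auto simp: j_def insert_commute l_def)
  moreover have "{v, c ! k} \<in> edges G"
  proof (cases "Suc i = l")
    case True
    then have "l - 1 = i" by simp
    then show ?thesis using True i cl by (simp add: k_def)
  qed (use i e[of i] in \<open>auto simp: k_def l_def\<close>)
  moreover have "c ! j \<noteq> c ! k" using jk c by (simp add: nth_eq_iff_index_eq)
  ultimately show ?thesis using that jk by (meson nth_mem)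
qed

section \<open>Leaves and perfect matchings\<close>

lemma degree_1_unique:
  assumes "degree G y = 1" "a \<in> neighbors G y" "b \<in> neighbors G y"
  shows "a = b"
  using assms unfolding degree_def by (metis card_1_singletonE singletonD)

lemma perfect_matching_edge:
  assumes "simple_graph G" "is_perfect_matching G M" "u \<in> verts G"
  obtains v where "{u, v} \<in> M" "{u, v} \<in> edges G"
proof -
  obtain e where e: "e \<in> M" "u \<in> e" using assms by (auto simp: is_perfect_matching_def)
  then have "e \<in> edges G" using assms by (auto simp: is_perfect_matching_def is_matching_def)
  then obtain a b where "e = {a, b}" using assms by (auto simp: simple_graph_def)
  then show ?thesis using that e \<open>e \<in> edges G\<close> by (auto simp: insert_commute)
qed

lemma matching_unique:
  assumes "is_perfect_matching G M" "{u, v} \<in> M" "{u, w} \<in> M"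
  shows "v = w"
proof (rule ccontr)
  assume "v \<noteq> w"
  then have "{u, v} \<noteq> {u, w}" by (auto simp: doubleton_eq_iff)
  moreover have "\<forall>e\<in>M. \<forall>f\<in>M. e \<noteq> f \<longrightarrow> e \<inter> f = {}"
    using assms(1) by (simp add: is_perfect_matching_def is_matching_def)
  ultimately have "{u, v} \<inter> {u, w} = {}" using assms(2,3) by metis
  then show False by simp
qed

text \<open>The only neighbour of a leaf is its only possible partner.\<close>

lemma perfect_matching_leaf:
  assumes "simple_graph G" "is_perfect_matching G M" "degree G y = 1" "{w, y} \<in> edges G"
  shows "{w, y} \<in> M"
proof -
  have "y \<in> verts G" using assms simple_graph_edgeD by metis
  then obtain v where v: "{y, v} \<in> M" "{y, v} \<in> edges G"
    using perfect_matching_edge assms by metis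
  have "v = w" using degree_1_unique[OF assms(3)] v assms
    by (simp add: neighbors_iff insert_commute)
  then show ?thesis using v by (simp add: insert_commute)
qed

text \<open>Both leaves have to be matched with \<open>w\<close>, which has only one
  partner.\<close>

lemma unique_leaf_neighbor:
  assumes "simple_graph G" "is_perfect_matching G M"
    "degree G y = 1" "{w, y} \<in> edges G" "degree G z = 1" "{w, z} \<in> edges G"
  shows "y = z"
  using matching_unique[OF assms(2)] perfect_matching_leaf[OF assms(1,2)] assms(3-) by blast

section \<open>Numerical estimates for the weighted sum\<close>

lemma two_power_ge: "n + 1 \<le> 2 ^ (n::nat)"
  by (induction n) auto

text \<open>This is \<open>D - 2\<close> times the sum of all local bounds, with
  \<open>c = card Y\<close>, \<open>l = card X\<close> and \<open>k = card W\<close>. For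
  \<open>l = 0\<close> it equals \<open>(R - (c + 1)) * (2 ^ k - (k + 1))\<close>; for
  \<open>l = 1\<close> the estimate \<open>c + 1 \<le> 2 * R\<close> leaves the surplus
  \<open>(c - 1) * k / 2\<close>.\<close>

lemma shift_balance_nonneg:
  fixes k l c R :: nat
  assumes "l \<le> 1" "2 ^ c \<le> (l + 1) * R" "1 \<le> c"
  shows "0 \<le> (real c + 1 + k) - (real c + 1) * 2 ^ k + real R * ((real l + 1) * 2 ^ k - (real k + real l + 1))
    - real l * k + real c * k"
proof -
  have "c + 1 \<le> (l + 1) * R" using two_power_ge[of c] assms(2) by linarith
  then have "real (c + 1) \<le> real ((l + 1) * R)" by (rule of_nat_mono)
  then have R: "real c + 1 \<le> (real l + 1) * R" by (simp add: algebra_simps)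
  have "real (k + 1) \<le> real (2 ^ k)" using two_power_ge by (rule of_nat_mono)
  then have p: "real k + 1 \<le> 2 ^ k" by simp
  consider "l = 0" | "l = 1" using assms(1) by linarith
  then show ?thesis
  proof cases
    case 1
    then have "(real c + 1) * (2 ^ k - (real k + 1)) \<le> real R * (2 ^ k - (real k + 1))"
      using R p by (intro mult_right_mono) auto
    then show ?thesis using 1 by (simp add: algebra_simps)
  next
    case 2
    then have "(real c + 1) * (2 * 2 ^ k - (real k + 2)) \<le> (2 * real R) * (2 * 2 ^ k - (real k + 2))"
      using R p by (intro mult_right_mono) auto
    moreover have "real k \<le> real c * real k" using assms(3) by (simp add: mult_le_cancel_right1)
    ultimately show ?thesis using 2 by (simp add: algebra_simps)
  qed
qed

text \<open>Replacing \<open>e\<close> by the smaller \<open>e'\<close> overestimates the old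
  quotient; the gain \<open>m' - m\<close> is nonnegative, so its weight may be lowered to
  \<open>1 / N\<close>.\<close>

lemma quotient_gain:
  fixes m m' e e' N :: real
  assumes "0 < e'" "e' \<le> e" "e' \<le> N" "m \<le> m'" "0 \<le> m"
  shows "(m' - m) / N \<le> m' / e' - m / e"
proof -
  have "(m' - m) / N \<le> (m' - m) / e'" using assms by (intro divide_left_mono) auto
  moreover have "m / e \<le> m / e'" using assms by (intro divide_left_mono) auto
  ultimately show ?thesis by (simp add: diff_divide_distrib)
qed

text \<open>Here the numerator may decrease, so \<open>N\<close> has to separate the two
  denominators.\<close>

lemma quotient_change:
  fixes m m' e e' N :: real
  assumes "0 < e'" "e' \<le> N" "N \<le> e" "0 \<le> m" "0 \<le> m'"
  shows "(m' - m) / N \<le> m' / e' - m / e"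
proof -
  have "m' / N \<le> m' / e'" using assms by (intro divide_left_mono) auto
  moreover have "m / e \<le> m / N" using assms by (intro divide_left_mono) auto
  ultimately show ?thesis by (simp add: diff_divide_distrib)
qed

section \<open>The branches at \<open>v2\<close> and eccentricities\<close>

text \<open>Six explicit vertices encode \<open>D \<ge> 5\<close>; \<open>Q\<close> is empty when
  the diameter is 5.\<close>

locale branch_shift =
  fixes T :: "'a sgraph" and M :: "'a set set" and v0 v1 v2 v3 v4 v5 :: 'a and Q :: "'a list"
  assumes tree: "is_tree T"
    and matching: "is_perfect_matching T M"
    and path: "is_path T (v0 # v1 # v2 # v3 # v4 # v5 # Q)"
    and diametric: "length (v0 # v1 # v2 # v3 # v4 # v5 # Q) = diam T + 1"
begin

abbreviation D where "D \<equiv> diam T"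

text \<open>\<open>L2\<close> and \<open>L3\<close> are the levels below \<open>v2\<close> of its side \<open>S\<close> of the edge \<open>v2v3\<close>, and \<open>shifted\<close> is the
  tree \<open>T'\<close>.\<close>

definition W where "W = {w \<in> verts T - {v3}. {v2, w} \<in> edges T \<and> degree T w = 2}"
definition X where "X = neighbors T v2 - {v3} - W"
definition Y where "Y = neighbors T v3 - {v2}"
definition L2 where "L2 = neighbors T v2 - {v3}"
definition L3 where "L3 = (\<Union>w\<in>L2. neighbors T w - {v2})"
definition S where "S = {v2} \<union> L2 \<union> L3"

definition cut where "cut = T\<lparr>edges := edges T - {{v2, w} | w. w \<in> W}\<rparr>"

definition shifted where
  "shifted = \<lparr>verts = verts T,
     edges = (edges T - {{v2, w} | w. w \<in> W}) \<union> {{v3, w} | w. w \<in> W}\<rparr>"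

lemma simple: "simple_graph T" and connected: "is_connected T"
  and acyclic: "\<nexists>c. is_cycle T c" and finite_verts: "finite (verts T)"
  using tree by (auto simp: is_tree_def simple_graph_def)

lemmas nbr = neighbors_iff[OF simple]
lemmas edgeD = simple_graph_edgeD[OF simple]
lemmas nb_distinct = tree_nonbacktracking_distinct[OF tree]

lemma P_distinct: "distinct (v0 # v1 # v2 # v3 # v4 # v5 # Q)"
  and P_walk: "is_walk T (v0 # v1 # v2 # v3 # v4 # v5 # Q)"
  using path unfolding is_path_def by blast+

lemma P_edges: "{v0, v1} \<in> edges T" "{v1, v2} \<in> edges T" "{v2, v3} \<in> edges T"
    "{v3, v4} \<in> edges T" "{v4, v5} \<in> edges T"
  and P_tail: "is_walk T (v2 # v3 # v4 # v5 # Q)"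
  using P_walk by (simp_all add: is_walk_Cons_Cons)

lemma P_verts: "v0 \<in> verts T" "v1 \<in> verts T" "v2 \<in> verts T" "v3 \<in> verts T" "v4 \<in> verts T"
  using P_edges edgeD by blast+

lemma diam_ge_5: "D \<ge> 5"
  using diametric by simp

lemma P_tail_nonbacktracking: "nonbacktracking (v2 # v3 # v4 # v5 # Q)"
  by (rule nonbacktracking_distinct) (use P_distinct in simp)

section \<open>Structure of the branches at \<open>v2\<close>\<close>

lemma L2_iff: "w \<in> L2 \<longleftrightarrow> {v2, w} \<in> edges T \<and> w \<noteq> v3"
  by (auto simp: L2_def nbr)

lemma L3_iff: "y \<in> L3 \<longleftrightarrow> (\<exists>w\<in>L2. {w, y} \<in> edges T \<and> y \<noteq> v2)"
  by (auto simp: L3_def nbr)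

lemma W_subset_L2: "W \<subseteq> L2"
  by (auto simp: W_def L2_iff)

lemma L2_eq: "L2 = W \<union> X" and W_X_disjoint: "W \<inter> X = {}"
  using W_subset_L2 by (auto simp: X_def L2_def)

text \<open>A vertex beyond \<open>y\<close> would extend \<open>v2 \<dots> vD\<close> to a path with more than \<open>D\<close> edges.\<close>

lemma L3_leaf:
  assumes "w \<in> L2" "{w, y} \<in> edges T" "y \<noteq> v2"
  shows "neighbors T y = {w}"
proof -
  have "z = w" if "{y, z} \<in> edges T" for z
  proof (rule ccontr)
    assume "z \<noteq> w"
    then have "nonbacktracking (z # y # w # v2 # v3 # v4 # v5 # Q)"
      using assms P_tail_nonbacktracking by (auto simp: L2_iff)
    moreover have "is_walk T (z # y # w # v2 # v3 # v4 # v5 # Q)"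
      using P_tail assms that edgeD by (auto simp: is_walk_Cons_Cons L2_iff insert_commute)
    ultimately have "length (z # y # w # v2 # v3 # v4 # v5 # Q) \<le> D + 1"
      by (intro tree_nonbacktracking_length[OF tree])
    then show False using diametric by simp
  qed
  moreover have "{y, w} \<in> edges T" using assms(2) by (rule edge_sym)
  ultimately show ?thesis unfolding set_eq_iff nbr by blast
qed

lemma L3E:
  assumes "y \<in> L3"
  obtains w where "w \<in> L2" "{w, y} \<in> edges T" "y \<noteq> v2" "neighbors T y = {w}"
proof -
  obtain w where "w \<in> L2" "{w, y} \<in> edges T" "y \<noteq> v2" using assms unfolding L3_iff by blast
  then show ?thesis using that L3_leaf by metis
qed

lemma L3_degree: "y \<in> L3 \<Longrightarrow> degree T y = 1"
  by (elim L3E) (simp add: degree_def)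

text \<open>Both vertices are leaves at \<open>w\<close>, and the perfect matching allows only
  one.\<close>

lemma L3_unique:
  "w \<in> L2 \<Longrightarrow> {w, y} \<in> edges T \<Longrightarrow> y \<noteq> v2 \<Longrightarrow> {w, z} \<in> edges T \<Longrightarrow> z \<noteq> v2 \<Longrightarrow> y = z"
  using unique_leaf_neighbor[OF simple matching, of y w z] L3_degree L3_iff by blast

lemma L2_inner:
  assumes "w \<in> L2" "{w, y} \<in> edges T" "y \<noteq> v2"
  shows "neighbors T w = {v2, y}" and "w \<in> W"
proof -
  show *: "neighbors T w = {v2, y}"
    using assms(1,2) L3_unique[OF assms] edge_sym[of v2 w] unfolding set_eq_iff nbr L2_iff by blast
  show "w \<in> W"
    using assms edgeD by (auto simp: W_def L2_iff degree_def *)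
qed

text \<open>\<open>v0\<close> is a neighbour of \<open>v1\<close> beyond \<open>v2\<close>, so this
  branch is always moved; strictness will come from it.\<close>

lemma v1_in_W: "v1 \<in> W"
  by (rule L2_inner[of _ v0]) (use P_edges P_distinct in \<open>auto simp: L2_iff insert_commute\<close>)

lemma v0_in_L3: "v0 \<in> L3"
  using v1_in_W W_subset_L2 P_edges P_distinct by (auto simp: L3_iff insert_commute intro!: bexI[of _ v1])

lemma W_leaf:
  assumes "w \<in> W"
  obtains y where "y \<in> L3" "{w, y} \<in> edges T" "y \<noteq> v2" "neighbors T w = {v2, y}"
    "neighbors T y = {w}" "v2 \<noteq> w"
proof -
  have w: "w \<in> L2" "card (neighbors T w) = 2" using assms W_subset_L2 by (auto simp: W_def degree_def)
  then have "\<not> neighbors T w \<subseteq> {v2}"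
    by (metis card.empty card_insert_disjoint empty_iff finite.emptyI numeral_2_eq_2 old.nat.inject
        subset_singleton_iff zero_neq_numeral zero_neq_one One_nat_def)
  then obtain y where "y \<in> neighbors T w" "y \<noteq> v2" by blast
  then have "{w, y} \<in> edges T" "y \<noteq> v2" by (simp_all add: nbr)
  note y = this
  have "y \<in> L3" using w(1) y L3_iff by blast
  moreover have "v2 \<noteq> w" using w(1) edgeD(3) L2_iff by blast
  ultimately show ?thesis using that y L2_inner(1)[OF w(1) y] L3_leaf[OF w(1) y] by blast
qed

text \<open>A further neighbour would put \<open>x\<close> into \<open>W\<close> by
  \<open>L2_inner\<close>.\<close>

lemma X_leaf:
  assumes "x \<in> X"
  shows "neighbors T x = {v2}" "degree T x = 1"
proof -
  have x: "x \<in> L2" "x \<notin> W" using assms L2_eq W_X_disjoint by auto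
  then show "neighbors T x = {v2}"
    using L2_inner(2)[OF x(1)] edge_sym[of v2 x] unfolding set_eq_iff nbr L2_iff by blast
  then show "degree T x = 1" by (simp add: degree_def)
qed

text \<open>Two leaves at \<open>v2\<close> would both be matched with \<open>v2\<close>.\<close>

lemma X_subsingleton: "x \<in> X \<Longrightarrow> x' \<in> X \<Longrightarrow> x = x'"
  using unique_leaf_neighbor[OF simple matching, of x v2 x'] X_leaf(2) L2_eq L2_iff by auto

lemma L3_distinct:
  assumes "w \<in> L2" "{w, y} \<in> edges T" "y \<noteq> v2"
  shows "distinct (y # w # v2 # v3 # v4 # v5 # Q)"
proof -
  have "is_walk T (y # w # v2 # v3 # v4 # v5 # Q)"
    using P_tail assms edgeD by (auto simp: is_walk_Cons_Cons L2_iff insert_commute)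
  moreover have "nonbacktracking (y # w # v2 # v3 # v4 # v5 # Q)"
    using assms P_tail_nonbacktracking by (auto simp: L2_iff)
  ultimately show ?thesis by (rule nb_distinct)
qed

lemma L2_distinct:
  assumes "w \<in> L2"
  shows "distinct (w # v2 # v3 # v4 # v5 # Q)"
proof -
  have "is_walk T (w # v2 # v3 # v4 # v5 # Q)"
    using P_tail assms edgeD by (auto simp: is_walk_Cons_Cons L2_iff insert_commute)
  moreover have "nonbacktracking (w # v2 # v3 # v4 # v5 # Q)"
    using assms P_tail_nonbacktracking by (auto simp: L2_iff)
  ultimately show ?thesis by (rule nb_distinct)
qed

text \<open>A branch prepended to the tail of the diametric path gives a path, so no vertex of the
  branch recurs on the tail.\<close>

lemma tail_disjoint_S: "u \<in> set (v3 # v4 # v5 # Q) \<Longrightarrow> u \<notin> S"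
proof
  assume u: "u \<in> set (v3 # v4 # v5 # Q)" "u \<in> S"
  consider "u = v2" | "u \<in> L2" | w where "w \<in> L2" "{w, u} \<in> edges T" "u \<noteq> v2"
    using u(2) by (auto simp: S_def L3_iff)
  then show False
  proof cases
    case 1 then show ?thesis using u(1) P_distinct by auto
  next
    case 2 then show ?thesis using u(1) L2_distinct by auto
  next
    case 3 then show ?thesis using u(1) L3_distinct[OF 3] by auto
  qed
qed

text \<open>In \<open>L2\<close>, \<open>y\<close> would close a triangle with \<open>v2\<close> and
  \<open>v3\<close>; in \<open>L3\<close> it would be a leaf with the second neighbour
  \<open>v3\<close>.\<close>

lemma Y_disjoint_S:
  assumes "y \<in> Y" shows "y \<notin> S"
proof
  assume u: "y \<in> S"
  have y: "{v3, y} \<in> edges T" "y \<noteq> v2" using assms by (auto simp: Y_def nbr)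
  consider "y \<in> L2" | w where "w \<in> L2" "{w, y} \<in> edges T" "y \<noteq> v2"
    using u y by (auto simp: S_def L3_iff)
  then show False
  proof cases
    case 1
    then have "distinct [y, v3, v2, y]"
      by (intro nb_distinct)
        (use y P_verts P_edges edgeD in \<open>auto simp: is_walk_Cons_Cons is_walk_single L2_iff insert_commute\<close>)
    then show ?thesis by simp
  next
    case 2
    then have "v3 \<in> neighbors T y" "v3 \<noteq> w" using y by (auto simp: nbr insert_commute L2_iff)
    then show ?thesis using L3_leaf[OF 2] by auto
  qed
qed

lemma v4_in_Y: "v4 \<in> Y"
  using P_edges P_distinct by (auto simp: Y_def nbr)

lemma v3_notin_S: "v3 \<notin> S" and v3_notin_W: "v3 \<notin> W"
  using tail_disjoint_S by (auto simp: W_def)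

lemma v2_notin_W: "v2 \<notin> W"
  using edgeD(3)[of v2 v2] by (auto simp: W_def)

lemma L3_disjoint_L2:
  assumes "y \<in> L3"
  shows "y \<notin> L2"
proof
  assume "y \<in> L2"
  then have "v2 \<in> neighbors T y" by (simp add: nbr L2_iff insert_commute)
  moreover obtain w where "w \<in> L2" "neighbors T y = {w}" using assms by (rule L3E)
  ultimately have "v2 \<in> L2" by auto
  then show False using edgeD(3) unfolding L2_iff by blast
qed

section \<open>Distances and eccentricities after the shift\<close>

lemma cut_simps [simp]: "verts cut = verts T" "edges cut = edges T - {{v2, w} | w. w \<in> W}"
  by (simp_all add: cut_def)

lemma verts_shifted [simp]: "verts shifted = verts T"
  and edges_shifted: "edges shifted = (edges T - {{v2, w} | w. w \<in> W}) \<union> {{v3, w} | w. w \<in> W}"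
  by (simp_all add: shifted_def)

lemma cut_edgeI: "{a, b} \<in> edges T \<Longrightarrow> a \<noteq> v2 \<Longrightarrow> b \<noteq> v2 \<Longrightarrow> {a, b} \<in> edges cut"
  by (auto simp: doubleton_eq_iff)

lemma shifted_edge_iff:
  "{a, b} \<in> edges shifted \<longleftrightarrow>
    {a, b} \<in> edges T \<and> \<not> (a = v2 \<and> b \<in> W) \<and> \<not> (b = v2 \<and> a \<in> W) \<or> a = v3 \<and> b \<in> W \<or> b = v3 \<and> a \<in> W"
  by (auto simp: edges_shifted doubleton_eq_iff)

lemma simple_shifted: "simple_graph shifted"
proof -
  have "\<exists>u\<in>verts T. \<exists>v\<in>verts T. u \<noteq> v \<and> e = {u, v}" if "e \<in> edges shifted" for e
  proof (cases "e \<in> edges T")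
    case True
    then show ?thesis using simple by (auto simp: simple_graph_def)
  next
    case False
    then obtain w where "w \<in> W" "e = {v3, w}" using \<open>e \<in> edges shifted\<close> by (auto simp: edges_shifted)
    then show ?thesis using v3_notin_W P_verts by (auto simp: W_def)
  qed
  then show ?thesis using finite_verts unfolding simple_graph_def by simp
qed

text \<open>A walk entering \<open>S\<close> must pass through \<open>v3\<close>, and the edges of \<open>cut\<close> are common to
  \<open>T\<close> and \<open>shifted\<close>.\<close>

lemma walk_from_outside:
  assumes "walk_len T m u z" "u \<notin> S"
  shows "(z \<notin> S \<longrightarrow> (\<exists>k\<le>m. walk_len cut k u z)) \<and>
    (z = v2 \<longrightarrow> (\<exists>k. k + 1 \<le> m \<and> walk_len cut k u v3)) \<and>
    (z \<in> L2 \<longrightarrow> (\<exists>k. k + 2 \<le> m \<and> walk_len cut k u v3)) \<and>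
    (z \<in> L3 \<longrightarrow> (\<exists>k. k + 3 \<le> m \<and> walk_len cut k u v3))"
  using assms
proof (induction rule: walk_len.induct)
  case (refl u)
  then have "walk_len cut 0 u u" by (intro walk_len.refl) simp
  then show ?case using refl by (auto simp: S_def)
next
  case (step n u v w)
  note IH = step.IH[OF \<open>u \<notin> S\<close>]
  have vw: "{v, w} \<in> edges T" "{w, v} \<in> edges T" using step by (auto simp: insert_commute)
  \<comment> \<open>One further edge of the walk raises the required number of edges beyond
    \<open>v3\<close> by at most one.\<close>
  have up: "\<exists>k. k + b \<le> Suc n \<and> walk_len cut k u v3"
    if ex: "\<exists>k. k + a \<le> n \<and> walk_len cut k u v3" and "b \<le> a + 1" for a b
  proof -
    obtain k where "k + a \<le> n" "walk_len cut k u v3" using ex by blast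
    then show ?thesis using that(2) by (intro exI[of _ k]) simp
  qed
  show ?case
  proof (intro conjI impI)
    assume w: "w \<notin> S"
    show "\<exists>k\<le>Suc n. walk_len cut k u w"
    proof (cases "v \<in> S")
      case False
      then obtain k where "k \<le> n" "walk_len cut k u v" using IH by blast
      moreover have "{v, w} \<in> edges cut"
        using w False vw by (intro cut_edgeI) (auto simp: S_def)
      ultimately show ?thesis using step walk_len.step[of cut k u v w] by auto
    next
      case True
      \<comment> \<open>The walk leaves \<open>S\<close> here. All neighbours of vertices in
        \<open>L2\<close> and \<open>L3\<close> lie in \<open>S\<close>, so the exit is from
        \<open>v2\<close>, and it leads to \<open>v3\<close>.\<close>
      have "v = v2"
      proof (rule ccontr)
        assume "v \<noteq> v2"
        then consider "v \<in> L2" | "v \<in> L3" using True by (auto simp: S_def)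
        then show False
        proof cases
          case 1
          then show ?thesis using w vw by (auto simp: S_def L3_iff)
        next
          case 2
          then obtain w' where "w' \<in> L2" "neighbors T v = {w'}" using L3E by metis
          then show ?thesis using w vw nbr[of w v] by (auto simp: S_def)
        qed
      qed
      moreover have "w = v3" using w vw \<open>v = v2\<close> by (auto simp: S_def L2_iff)
      ultimately show ?thesis using up[of 1 0] IH by auto
    qed
  next
    assume w: "w = v2"
    then have "v = v3 \<or> v \<in> L2" using vw by (auto simp: L2_iff)
    then show "\<exists>k. k + 1 \<le> Suc n \<and> walk_len cut k u v3"
      using IH v3_notin_S up[of 0 1] up[of 2 1] by auto
  next
    assume w: "w \<in> L2"
    then have "v = v2 \<or> v \<in> L3" using vw by (auto simp: L3_iff)
    then show "\<exists>k. k + 2 \<le> Suc n \<and> walk_len cut k u v3"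
      using IH up[of 1 2] up[of 3 2] by auto
  next
    assume w: "w \<in> L3"
    then have "v \<in> L2" using vw(2) nbr by (metis L3E singletonD)
    then show "\<exists>k. k + 3 \<le> Suc n \<and> walk_len cut k u v3"
      using IH up[of 2 3] by auto
  qed
qed

lemma cut_walk_T: "walk_len cut k u v \<Longrightarrow> walk_len T k u v"
  and cut_walk_shifted: "walk_len cut k u v \<Longrightarrow> walk_len shifted k u v"
  by (erule walk_len_mono; auto simp: edges_shifted)+

lemma shifted_v3_v2: "walk_len shifted 1 v3 v2"
proof (rule walk_len_edge[OF simple_shifted])
  show "{v3, v2} \<in> edges shifted"
    using edge_sym[OF P_edges(3)] v3_notin_W v2_notin_W P_distinct unfolding shifted_edge_iff by simp
qed

lemma shifted_v3_W: "w \<in> W \<Longrightarrow> walk_len shifted 1 v3 w"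
  by (intro walk_len_edge simple_shifted) (simp add: shifted_edge_iff)

lemma shifted_v3_X:
  assumes "x \<in> X" shows "walk_len shifted 2 v3 x"
proof -
  have "{v2, x} \<in> edges shifted"
    using assms W_X_disjoint L2_eq L2_iff v2_notin_W by (auto simp: shifted_edge_iff)
  then show ?thesis
    using walk_len_trans[OF walk_len_edge[OF simple_shifted] shifted_v3_v2]
    by (simp add: numeral_2_eq_2)
qed

text \<open>The leaf of a moved branch comes one step closer, since its neighbour \<open>w\<close>
  is now adjacent to \<open>v3\<close>.\<close>

lemma shifted_v3_L3:
  assumes "y \<in> L3" shows "walk_len shifted 2 v3 y"
proof -
  obtain w where w: "w \<in> L2" "{w, y} \<in> edges T" "y \<noteq> v2" using assms L3_iff by blast
  then have "w \<in> W" by (rule L2_inner)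
  then have "{w, y} \<in> edges shifted"
    using w v2_notin_W by (auto simp: shifted_edge_iff)
  then show ?thesis
    using walk_len_trans[OF walk_len_edge[OF simple_shifted] shifted_v3_W[OF \<open>w \<in> W\<close>]]
    by (simp add: numeral_2_eq_2)
qed

lemma S_cases:
  assumes "u \<in> S"
  obtains (v2) "u = v2" | (W) "u \<in> W" | (X) "u \<in> X" | (L3) "u \<in> L3"
  using assms L2_eq by (auto simp: S_def)

text \<open>Vertices of \<open>S\<close> are within two of \<open>v3\<close>, and
  \<open>2 \<le> D - 3\<close>. From outside \<open>S\<close>, a shortest walk to \<open>v0\<close>
  has at most \<open>D\<close> edges, of which at least three come after \<open>v3\<close>.\<close>

lemma shifted_dist_v3:
  assumes "z \<in> verts T"
  shows "\<exists>k\<le>D - 3. walk_len shifted k v3 z"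
proof (cases "z \<in> S")
  case True
  then show ?thesis
  proof (cases rule: S_cases)
    case v2 then show ?thesis using shifted_v3_v2 diam_ge_5 by (intro exI[of _ 1]) auto
  next
    case W then show ?thesis using shifted_v3_W diam_ge_5 by (intro exI[of _ 1]) auto
  next
    case X then show ?thesis using shifted_v3_X diam_ge_5 by (intro exI[of _ 2]) auto
  next
    case L3 then show ?thesis using shifted_v3_L3 diam_ge_5 by (intro exI[of _ 2]) auto
  qed
next
  case False
  obtain k where k: "k + 3 \<le> gdist T z v0" "walk_len cut k z v3"
    using walk_from_outside[OF walk_len_gdist[OF connected assms P_verts(1)] False] v0_in_L3 by blast
  moreover have "gdist T z v0 \<le> D" by (rule gdist_le_diam[OF finite_verts assms P_verts(1)])
  ultimately show ?thesis using walk_len_sym[OF cut_walk_shifted[OF k(2)]] by (intro exI[of _ k]) auto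
qed

lemma connected_shifted: "is_connected shifted"
  using P_verts(4) shifted_dist_v3 by (intro is_connectedI[of v3]) auto

text \<open>Route every walk through \<open>v3\<close>, which is within \<open>D - 3\<close> of all
  vertices.\<close>

lemma ecc_shifted_le:
  assumes "walk_len shifted j v3 u"
  shows "eccentricity shifted u \<le> D - 3 + j"
proof (rule eccentricity_le)
  fix v assume "v \<in> verts shifted"
  then obtain k where "k \<le> D - 3" "walk_len shifted k v3 v" using shifted_dist_v3 by auto
  then show "\<exists>k\<le>D - 3 + j. walk_len shifted k u v"
    using walk_len_trans[OF _ walk_len_sym[OF assms]] by (intro exI[of _ "j + k"]) auto
qed (use finite_verts P_verts in auto)

abbreviation "vD \<equiv> last (v5 # Q)"

lemma vD_verts: "vD \<in> verts T" and vD_notin_S: "vD \<notin> S"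
proof -
  have "vD \<in> set (v5 # Q)" by (rule last_in_set) simp
  then show "vD \<in> verts T" "vD \<notin> S" using P_walk tail_disjoint_S[of vD] by (auto simp: is_walk_def)
qed

text \<open>A shorter walk, continued by the three edges from \<open>v3\<close> to
  \<open>v0\<close>, would undercut the distance \<open>D\<close> between the ends of the diametric
  path.\<close>

lemma cut_walk_vD_v3_ge:
  assumes "walk_len cut k vD v3"
  shows "D \<le> k + 3"
proof -
  have "gdist T v0 vD = D" using tree_path_gdist[OF tree path] diametric by simp
  moreover have "walk_len T 3 v0 v3"
    using is_walk_walk_len[OF is_walk_take[OF P_walk, of 4]] by (simp add: numeral_3_eq_3)
  then have "walk_len T (3 + k) v0 vD"
    by (rule walk_len_trans[OF walk_len_sym[OF cut_walk_T[OF assms]]])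
  ultimately show ?thesis using gdist_le[of T "3 + k" v0 vD] by simp
qed

text \<open>The far end \<open>vD\<close> is the witness: a walk from it into \<open>S\<close> first
  reaches \<open>v3\<close>, which takes at least \<open>D - 3\<close> edges.\<close>

lemma ecc_ge:
  assumes "u \<in> verts T"
  shows "u = v2 \<Longrightarrow> D - 2 \<le> eccentricity T u" "u \<in> L2 \<Longrightarrow> D - 1 \<le> eccentricity T u"
    "u \<in> L3 \<Longrightarrow> D \<le> eccentricity T u"
proof -
  have "walk_len T (gdist T u vD) u vD" using walk_len_gdist[OF connected assms vD_verts] .
  note * = walk_from_outside[OF walk_len_sym[OF this] vD_notin_S]
  have "gdist T u vD \<le> eccentricity T u" using eccentricity_ge[OF finite_verts vD_verts] .
  then show "u = v2 \<Longrightarrow> D - 2 \<le> eccentricity T u" "u \<in> L2 \<Longrightarrow> D - 1 \<le> eccentricity T u"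
    "u \<in> L3 \<Longrightarrow> D \<le> eccentricity T u"
    using * cut_walk_vD_v3_ge by fastforce+
qed

text \<open>Inside \<open>S\<close>, the lower bounds in \<open>T\<close> are compared with
  \<open>D - 3\<close> plus the new distance from \<open>v3\<close>. For \<open>u\<close> outside
  \<open>S\<close>, a shortest walk is kept up to \<open>v3\<close> and its continuation into
  \<open>S\<close> is replaced by one that is no longer.\<close>

lemma ecc_decreases:
  assumes u: "u \<in> verts T"
  shows "eccentricity shifted u \<le> eccentricity T u"
proof (cases "u \<in> S")
  case True
  then show ?thesis
  proof (cases rule: S_cases)
    case v2 then show ?thesis using ecc_ge(1)[OF u] ecc_shifted_le[of 1 u] shifted_v3_v2 diam_ge_5 by simp
  next
    case W then show ?thesis using ecc_ge(2)[OF u] ecc_shifted_le[of 1 u] shifted_v3_W diam_ge_5 L2_eq by fastforce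
  next
    case X then show ?thesis using ecc_ge(2)[OF u] ecc_shifted_le[of 2 u] shifted_v3_X diam_ge_5 L2_eq by fastforce
  next
    case L3 then show ?thesis using ecc_ge(3)[OF u] ecc_shifted_le[of 2 u] shifted_v3_L3 diam_ge_5 by fastforce
  qed
next
  case False
  show ?thesis
  proof (rule eccentricity_le)
    fix z assume "z \<in> verts shifted"
    then have z: "z \<in> verts T" by simp
    let ?m = "gdist T u z"
    have "walk_len T ?m u z" using walk_len_gdist[OF connected u z] .
    note * = walk_from_outside[OF this False]
    \<comment> \<open>The old walk spends at least \<open>a\<close> edges beyond \<open>v3\<close>,
      the new one \<open>b\<close>.\<close>
    have via: "\<exists>k\<le>?m. walk_len shifted k u z"
      if ex: "\<exists>k. k + a \<le> ?m \<and> walk_len cut k u v3"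
        and "walk_len shifted b v3 z" "b \<le> a" for a b
    proof -
      obtain k where "k + a \<le> ?m" "walk_len cut k u v3" using ex by blast
      then show ?thesis using walk_len_trans[OF that(2) cut_walk_shifted] that(3)
        by (intro exI[of _ "k + b"]) auto
    qed
    have "\<exists>k\<le>?m. walk_len shifted k u z"
    proof (cases "z \<in> S")
      case True
      then show ?thesis
      proof (cases rule: S_cases)
        case v2 then show ?thesis using * via[of 1 1] shifted_v3_v2 by auto
      next
        case W then show ?thesis using * via[of 2 1] shifted_v3_W L2_eq by auto
      next
        case X then show ?thesis using * via[of 2 2] shifted_v3_X L2_eq by auto
      next
        case L3 then show ?thesis using * via[of 3 2] shifted_v3_L3 by auto
      qed
    next
      case False
      then show ?thesis using * cut_walk_shifted by blast
    qed
    moreover have "?m \<le> eccentricity T u" using eccentricity_ge[OF finite_verts z] .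
    ultimately show "\<exists>k\<le>eccentricity T u. walk_len shifted k u z"
      by (meson le_trans)
  qed (use finite_verts P_verts in auto)
qed

lemma ecc_shifted_pos:
  assumes "u \<in> verts T"
  shows "0 < eccentricity shifted u"
proof -
  have "\<exists>v\<in>verts T. u \<noteq> v" using P_verts P_distinct by (cases "u = v0") auto
  then show ?thesis using eccentricity_pos[of shifted u] finite_verts connected_shifted assms by auto
qed

section \<open>The shifted graph is a tree with a perfect matching\<close>

lemma v3_nbr: "neighbors shifted v3 = neighbors T v3 \<union> W"
  unfolding set_eq_iff neighbors_iff[OF simple_shifted] shifted_edge_iff
  using v3_notin_W P_distinct by (auto simp: nbr)

lemma v2_nbr: "neighbors shifted v2 = insert v3 X"
  unfolding set_eq_iff neighbors_iff[OF simple_shifted] shifted_edge_iff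
  using v2_notin_W v3_notin_W P_distinct P_edges by (auto simp: nbr X_def)

lemma W_nbr:
  assumes "w \<in> W"
  shows "neighbors shifted w = insert v3 (neighbors T w - {v2})"
  unfolding set_eq_iff neighbors_iff[OF simple_shifted] shifted_edge_iff
  using v2_notin_W v3_notin_W assms by (auto simp: nbr)

lemma other_nbr: "u \<notin> W \<Longrightarrow> u \<noteq> v2 \<Longrightarrow> u \<noteq> v3 \<Longrightarrow> neighbors shifted u = neighbors T u"
  unfolding set_eq_iff neighbors_iff[OF simple_shifted] shifted_edge_iff by (auto simp: nbr)

text \<open>Leaves in \<open>L3\<close> lie on no cycle; then a vertex of \<open>W\<close> has only
  \<open>v3\<close> left as a neighbour on the cycle, so it is excluded too. A cycle avoiding
  \<open>W\<close> uses only edges of \<open>T\<close>.\<close>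

lemma acyclic_shifted: "\<not> is_cycle shifted c"
proof
  assume c: "is_cycle shifted c"
  have L3: "y \<notin> set c" if y: "y \<in> L3" for y
  proof
    assume "y \<in> set c"
    then obtain a b where ab: "a \<noteq> b" "a \<in> neighbors shifted y" "b \<in> neighbors shifted y"
      using cycle_two_neighbors[OF c] neighbors_iff[OF simple_shifted] by metis
    have "neighbors shifted y = neighbors T y"
      using y L3_disjoint_L2[OF y] W_subset_L2 v3_notin_S by (intro other_nbr) (auto simp: S_def L3_iff)
    then show False using ab degree_1_unique L3_degree[OF y] by metis
  qed
  have W: "w \<notin> set c" if w: "w \<in> W" for w
  proof
    assume "w \<in> set c"
    then obtain a b where ab: "a \<noteq> b" "a \<in> neighbors shifted w" "b \<in> neighbors shifted w"
       "a \<in> set c" "b \<in> set c"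
      using cycle_two_neighbors[OF c] neighbors_iff[OF simple_shifted] by metis
    obtain y where "y \<in> L3" "neighbors T w = {v2, y}" using W_leaf[OF w] by metis
    then have "a = v3" "b = v3" using ab W_nbr[OF w] L3 by auto
    then show False using ab by simp
  qed
  have e: "{a, b} \<in> edges T" if "{a, b} \<in> edges shifted" "a \<in> set c" "b \<in> set c" for a b
    using that W unfolding shifted_edge_iff by blast
  have ne: "c \<noteq> []" using c by (auto simp: is_cycle_def)
  have "is_cycle T c"
    using c e ne unfolding is_cycle_def is_path_def is_walk_def
    by auto
  then show False using acyclic by blast
qed

lemma tree_shifted: "is_tree shifted"
  using simple_shifted connected_shifted acyclic_shifted by (simp add: is_tree_def)

text \<open>The partner of \<open>w\<close> is its own leaf. Hence no edge of \<open>M\<close> is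
  deleted, and \<open>M\<close> serves for \<open>shifted\<close> as well.\<close>

lemma W_not_matched: "w \<in> W \<Longrightarrow> {v2, w} \<notin> M"
proof
  assume w: "w \<in> W" "{v2, w} \<in> M"
  obtain y where y: "y \<in> L3" "{w, y} \<in> edges T" "y \<noteq> v2" using W_leaf[OF w(1)] by metis
  then have "{w, y} \<in> M" using perfect_matching_leaf[OF simple matching] L3_degree by blast
  then show False using matching_unique[OF matching, of w y v2] w y by (simp add: insert_commute)
qed

lemma matching_shifted: "is_perfect_matching shifted M"
  using matching W_not_matched
  by (auto simp: is_perfect_matching_def is_matching_def edges_shifted)

section \<open>Degree products\<close>

lemma finite_W_X_Y: "finite W" "finite X" "finite Y"
  using finite_neighbors[OF simple] finite_verts by (auto simp: W_def X_def Y_def)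

lemma WXY_verts: "W \<subseteq> verts T" "X \<subseteq> verts T" "Y \<subseteq> verts T"
  by (auto simp: W_def X_def Y_def neighbors_def)

lemma WX_S: "W \<subseteq> S" "X \<subseteq> S"
  using L2_eq by (auto simp: S_def)

lemma v2_notin_X: "v2 \<notin> X" and v3_notin_X: "v3 \<notin> X" and v3_notin_Y: "v3 \<notin> Y" and v2_notin_Y: "v2 \<notin> Y"
  using edgeD(3)[of v2 v2] edgeD(3)[of v3 v3] by (auto simp: X_def Y_def nbr)

lemma Y_disjoint: "Y \<inter> W = {}" "Y \<inter> X = {}"
  using Y_disjoint_S WX_S by auto

lemma card_X: "card X \<le> 1"
  using X_subsingleton finite_W_X_Y by (auto simp: card_le_Suc0_iff_eq)

lemma card_Y: "1 \<le> card Y"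
  using v4_in_Y finite_W_X_Y by (metis One_nat_def Suc_leI card_gt_0_iff empty_iff)

lemma v2_nbr_T: "neighbors T v2 = insert v3 (W \<union> X)"
  unfolding L2_eq[symmetric] using P_edges(3) by (auto simp: L2_def nbr)

lemma v3_nbr_T: "neighbors T v3 = insert v2 Y"
  using edge_sym[OF P_edges(3)] by (auto simp: Y_def nbr)

lemma v2_degree: "degree T v2 = card W + card X + 1"
  unfolding degree_def v2_nbr_T using v3_notin_W v3_notin_X finite_W_X_Y W_X_disjoint
  by (simp add: card_Un_disjoint)

lemma v2_degree_shifted: "degree shifted v2 = card X + 1"
  unfolding degree_def v2_nbr using v3_notin_X finite_W_X_Y by simp

lemma v3_degree: "degree T v3 = card Y + 1"
  unfolding degree_def v3_nbr_T using v2_notin_Y finite_W_X_Y by simp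

lemma v3_nbr_shifted: "neighbors shifted v3 = insert v2 (Y \<union> W)"
  unfolding v3_nbr v3_nbr_T by auto

lemma v3_degree_shifted: "degree shifted v3 = card Y + card W + 1"
  unfolding degree_def v3_nbr_shifted using v2_notin_Y v2_notin_W finite_W_X_Y Y_disjoint
  by (simp add: card_Un_disjoint)

text \<open>A moved \<open>w\<close> trades the neighbour \<open>v2\<close> for \<open>v3\<close>;
  the other neighbourhoods in question are unchanged.\<close>

lemma other_degree:
  assumes "u \<noteq> v2" "u \<noteq> v3"
  shows "degree shifted u = degree T u"
proof (cases "u \<in> W")
  case True
  obtain y where y: "y \<in> L3" "y \<noteq> v2" "neighbors T u = {v2, y}" using W_leaf[OF True] by metis
  then have "neighbors shifted u = {v3, y}" using W_nbr[OF True] by auto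
  moreover have "y \<noteq> v3" using y v3_notin_S by (auto simp: S_def)
  ultimately show ?thesis using y by (simp add: degree_def)
next
  case False
  then show ?thesis using other_nbr assms by (simp add: degree_def)
qed

lemma degree_pos: "{u, v} \<in> edges T \<Longrightarrow> 1 \<le> degree T v"
  using finite_neighbors[OF simple] edge_sym[of u v] unfolding degree_def
  by (metis One_nat_def Suc_leI card_gt_0_iff empty_iff nbr)

lemma W_degree: "w \<in> W \<Longrightarrow> degree T w = 2"
  by (simp add: W_def)

definition R where "R = (\<Prod>y\<in>Y. degree T y)"

lemma v2_prod: "neighbor_degree_prod T v2 = (card Y + 1) * 2 ^ card W"
proof -
  have "(\<Prod>w\<in>W. degree T w) = 2 ^ card W" by (simp add: W_degree)
  moreover have "(\<Prod>x\<in>X. degree T x) = 1" by (simp add: X_leaf)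
  ultimately show ?thesis
    unfolding neighbor_degree_prod_def v2_nbr_T
    using v3_notin_W v3_notin_X finite_W_X_Y W_X_disjoint
    by (simp add: prod.union_disjoint v3_degree)
qed

lemma v2_prod_shifted: "neighbor_degree_prod shifted v2 = card Y + card W + 1"
proof -
  have "(\<Prod>x\<in>X. degree shifted x) = (\<Prod>x\<in>X. 1)"
    by (intro prod.cong) (use v2_notin_X v3_notin_X other_degree X_leaf(2) in metis)+
  then show ?thesis
    unfolding neighbor_degree_prod_def v2_nbr using v3_notin_X finite_W_X_Y
    by (simp add: v3_degree_shifted)
qed

lemma v3_prod: "neighbor_degree_prod T v3 = (card W + card X + 1) * R"
  unfolding neighbor_degree_prod_def v3_nbr_T R_def
  using v2_notin_Y finite_W_X_Y by (simp add: v2_degree)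

lemma v3_prod_shifted: "neighbor_degree_prod shifted v3 = (card X + 1) * 2 ^ card W * R"
proof -
  have "(\<Prod>w\<in>W. degree shifted w) = (\<Prod>w\<in>W. 2)"
    by (intro prod.cong) (use v2_notin_W v3_notin_W other_degree W_degree in metis)+
  moreover have "(\<Prod>y\<in>Y. degree shifted y) = R"
    unfolding R_def by (intro prod.cong) (use v2_notin_Y v3_notin_Y other_degree in metis)+
  ultimately show ?thesis
    unfolding neighbor_degree_prod_def v3_nbr_shifted
    using v2_notin_Y v2_notin_W finite_W_X_Y Y_disjoint
    by (simp add: prod.union_disjoint v2_degree_shifted algebra_simps)
qed

lemma X_prod:
  assumes "x \<in> X"
  shows "neighbor_degree_prod T x = card W + 2" "neighbor_degree_prod shifted x = 2"
proof -
  \<comment> \<open>The presence of \<open>x\<close> makes \<open>X\<close> a singleton, which fixes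
    the degree of \<open>v2\<close> before and after the shift.\<close>
  have "card X = 1" using card_X assms finite_W_X_Y by (metis card_0_eq empty_iff le_neq_implies_less less_one)
  moreover have "neighbors shifted x = {v2}"
    using other_nbr[of x] X_leaf(1)[OF assms] assms W_X_disjoint v2_notin_X v3_notin_X by auto
  ultimately show "neighbor_degree_prod T x = card W + 2" "neighbor_degree_prod shifted x = 2"
    by (simp_all add: neighbor_degree_prod_def X_leaf(1)[OF assms] v2_degree v2_degree_shifted)
qed

text \<open>The old degree of \<open>v2\<close> is replaced by the new degree of \<open>v3\<close>,
  which is no smaller because \<open>card X \<le> 1 \<le> card Y\<close>; the leaf contributes the
  factor 1.\<close>

lemma W_prod:
  assumes "w \<in> W"
  shows "neighbor_degree_prod T w \<le> neighbor_degree_prod shifted w" "0 < neighbor_degree_prod T w"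
proof -
  obtain y where y: "y \<in> L3" "y \<noteq> v2" "neighbors T w = {v2, y}" using W_leaf[OF assms] by metis
  then have n: "neighbors shifted w = {v3, y}" using W_nbr[OF assms] by auto
  have "y \<noteq> v3" using y v3_notin_S by (auto simp: S_def)
  then have "neighbor_degree_prod T w = card W + card X + 1"
    "neighbor_degree_prod shifted w = card Y + card W + 1"
    using y n L3_degree by (simp_all add: neighbor_degree_prod_def v2_degree v3_degree_shifted other_degree)
  then show "neighbor_degree_prod T w \<le> neighbor_degree_prod shifted w" "0 < neighbor_degree_prod T w"
    using card_X card_Y by auto
qed

text \<open>Among the neighbours of \<open>y\<close> only \<open>v3\<close> changes its degree, by
  \<open>card W\<close>; the remaining factor \<open>q\<close> is at least 1.\<close>

lemma Y_prod:
  assumes "y \<in> Y"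
  shows "neighbor_degree_prod T y + card W \<le> neighbor_degree_prod shifted y"
proof -
  have ne: "y \<notin> W" "y \<noteq> v2" "y \<noteq> v3" using assms Y_disjoint v2_notin_Y v3_notin_Y by auto
  define B where "B = neighbors T y - {v3}"
  define q where "q = (\<Prod>u\<in>B. degree T u)"
  have "{v3, y} \<in> edges T" using assms by (simp add: Y_def nbr)
  then have N: "neighbors T y = insert v3 B"
    using edge_sym by (auto simp: B_def nbr)
  have B: "finite B" "v3 \<notin> B" using finite_neighbors[OF simple] by (auto simp: B_def)
  have "v2 \<notin> B"
  proof
    assume "v2 \<in> B"
    then have "{v2, y} \<in> edges T" using edge_sym[of y v2] by (simp add: B_def nbr)
    then have "y \<in> L2" using ne by (simp add: L2_iff)
    then show False using Y_disjoint_S[OF assms] by (simp add: S_def)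
  qed
  then have "(\<Prod>u\<in>B. degree shifted u) = q"
    unfolding q_def using B by (intro prod.cong) (auto intro: other_degree)
  then have "neighbor_degree_prod shifted y = (card Y + card W + 1) * q"
    using B by (simp add: neighbor_degree_prod_def other_nbr[OF ne] N v3_degree_shifted)
  moreover have "neighbor_degree_prod T y = (card Y + 1) * q"
    using B by (simp add: neighbor_degree_prod_def N v3_degree q_def)
  moreover have "1 \<le> q"
    unfolding q_def using degree_pos by (intro prod_ge_1) (auto simp: B_def nbr)
  ultimately show ?thesis by (simp add: add_mult_distrib)
qed

text \<open>Only \<open>v2\<close> and \<open>v3\<close> change their degrees, and such a
  \<open>u\<close> is adjacent to neither.\<close>

lemma other_prod_eq:
  assumes "u \<noteq> v2" "u \<noteq> v3" "u \<notin> W" "u \<notin> X" "u \<notin> Y"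
  shows "neighbor_degree_prod shifted u = neighbor_degree_prod T u"
  unfolding neighbor_degree_prod_def other_nbr[OF assms(3,1,2)]
proof (rule prod.cong)
  fix v assume v: "v \<in> neighbors T u"
  then have "u \<in> neighbors T v" using edge_sym[of u v] by (simp add: nbr)
  then have "v \<noteq> v2" "v \<noteq> v3" using assms v2_nbr_T v3_nbr_T by auto
  then show "degree shifted v = degree T v" by (rule other_degree)
qed simp

text \<open>Without leaves in \<open>Y\<close> every factor of \<open>R\<close> is at least 2. A
  leaf \<open>y\<close> in \<open>Y\<close> is matched with \<open>v3\<close>, so \<open>v2\<close>
  must be matched with a vertex of \<open>X\<close>; then \<open>card X + 1 = 2\<close> makes up for
  the factor 1 of \<open>y\<close>, and no other vertex of \<open>Y\<close> is a leaf.\<close>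

lemma R_lower_bound: "2 ^ card Y \<le> (card X + 1) * R"
proof (cases "\<exists>y\<in>Y. degree T y = 1")
  case False
  have "2 \<le> degree T y" if "y \<in> Y" for y
  proof -
    have "1 \<le> degree T y" using that by (intro degree_pos[of v3]) (simp add: Y_def nbr)
    moreover have "degree T y \<noteq> 1" using that False by blast
    ultimately show ?thesis by simp
  qed
  then have "(\<Prod>y\<in>Y. 2) \<le> R" unfolding R_def by (intro prod_mono) auto
  then show ?thesis by simp
next
  case True
  then obtain y where y: "y \<in> Y" "degree T y = 1" by blast
  have yv: "{v3, z} \<in> edges T" "z \<noteq> v2" if "z \<in> Y" for z using that by (auto simp: Y_def nbr)
  have "X \<noteq> {}"
  proof
    assume "X = {}"
    obtain u where u: "{v2, u} \<in> M" "{v2, u} \<in> edges T"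
      using perfect_matching_edge[OF simple matching P_verts(3)] .
    then have "u \<in> insert v3 (W \<union> X)" using v2_nbr_T nbr by blast
    then have "u = v3" using W_not_matched u \<open>X = {}\<close> by blast
    then have "{v3, v2} \<in> M" using edge_sym[OF u(1)] by simp
    moreover have "{v3, y} \<in> M" using perfect_matching_leaf[OF simple matching y(2)] yv(1)[OF y(1)] .
    ultimately show False using matching_unique[OF matching] yv(2)[OF y(1)] by metis
  qed
  then have "card X = 1" using card_X finite_W_X_Y by (metis card_0_eq le_neq_implies_less less_one)
  have "2 \<le> degree T z" if "z \<in> Y - {y}" for z
  proof -
    have "degree T z \<noteq> 1"
      using unique_leaf_neighbor[OF simple matching y(2) yv(1)[OF y(1)], of z] that yv(1)[of z] by auto
    then show ?thesis using degree_pos[OF yv(1), of z] that by simp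
  qed
  then have "(\<Prod>z\<in>Y - {y}. 2) \<le> (\<Prod>z\<in>Y - {y}. degree T z)" by (intro prod_mono) auto
  moreover have "R = (\<Prod>z\<in>Y - {y}. degree T z)"
    unfolding R_def using prod.remove[OF finite_W_X_Y(3) y(1), of "degree T"] y(2) by simp
  moreover have "card Y = Suc (card (Y - {y}))"
    using y(1) finite_W_X_Y(3) by (metis card.remove)
  ultimately show ?thesis using \<open>card X = 1\<close> by simp
qed

section \<open>Summing the local changes\<close>

lemma xi_ac_shifted: "xi_ac T < xi_ac shifted"
proof -
  define f where "f u = real (neighbor_degree_prod T u) / real (eccentricity T u)" for u
  define f' where "f' u = real (neighbor_degree_prod shifted u) / real (eccentricity shifted u)" for u
  \<comment> \<open>\<open>D - 2\<close> bounds the new eccentricities of \<open>v2\<close>,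
    \<open>v3\<close> and the vertices of \<open>Y\<close> from above, and the old one of
    \<open>v2\<close> from below.\<close>
  define N where "N = real D - 2"
  define k where "k = real (card W)"
  define c2 where "c2 = ((real (card Y) + 1 + k) - (real (card Y) + 1) * 2 ^ card W) / N"
  define c3 where "c3 = real R * ((real (card X) + 1) * 2 ^ card W - (k + real (card X) + 1)) / N"
  \<comment> \<open>\<open>g u\<close> will be a lower bound for the change of the summand at
    \<open>u\<close>; the supports of its four terms are pairwise disjoint.\<close>
  define g where "g u = (if u = v2 then c2 else 0) + (if u = v3 then c3 else 0)
    + (if u \<in> X then - k / N else 0) + (if u \<in> Y then k / N else 0)" for u
  have N: "N > 0" using diam_ge_5 by (simp add: N_def)
  note pos = ecc_shifted_pos and dec = ecc_decreases
  have le_N: "real (eccentricity shifted u) \<le> N" if "walk_len shifted 1 v3 u" for u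
    using ecc_shifted_le[OF that] diam_ge_5 by (simp add: N_def)
  have gain: "f u \<le> f' u"
    if "u \<in> verts T" "neighbor_degree_prod T u \<le> neighbor_degree_prod shifted u" for u
    unfolding f_def f'_def using pos[OF that(1)] dec[OF that(1)] that(2) by (intro frac_le) auto
  have bound: "f u + g u \<le> f' u" if u: "u \<in> verts T" for u
  proof -
    consider "u = v2" | "u = v3" | "u \<in> X" | "u \<in> Y" | "u \<in> W"
      | "u \<noteq> v2" "u \<noteq> v3" "u \<notin> X" "u \<notin> Y" "u \<notin> W" by blast
    then show ?thesis
    proof cases
      case 1
      have "real (eccentricity T v2) \<ge> N" using ecc_ge(1)[OF P_verts(3)] diam_ge_5 by (simp add: N_def)
      then have "c2 \<le> f' v2 - f v2"
        using quotient_change[of "real (eccentricity shifted v2)" N "real (eccentricity T v2)"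
            "real (neighbor_degree_prod T v2)" "real (neighbor_degree_prod shifted v2)"]
          pos[OF P_verts(3)] le_N[OF shifted_v3_v2]
        by (simp add: f_def f'_def c2_def v2_prod v2_prod_shifted k_def algebra_simps)
      moreover have "v2 \<noteq> v3" using P_distinct by simp
      ultimately show ?thesis using 1 v2_notin_X v2_notin_Y by (simp add: g_def)
    next
      case 2
      have "card W + card X + 1 \<le> (card X + 1) * 2 ^ card W"
      proof -
        have "(card X + 1) * (card W + 1) \<le> (card X + 1) * 2 ^ card W"
          using two_power_ge by (rule mult_le_mono2)
        then show ?thesis by (simp add: algebra_simps)
      qed
      then have "neighbor_degree_prod T v3 \<le> neighbor_degree_prod shifted v3"
        unfolding v3_prod v3_prod_shifted by (rule mult_le_mono1)
      moreover have "walk_len shifted 0 v3 v3" using P_verts by (intro walk_len.refl) simp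
      then have "real (eccentricity shifted v3) \<le> N"
        using ecc_shifted_le[of 0 v3] diam_ge_5 by (simp add: N_def)
      ultimately have "(real (neighbor_degree_prod shifted v3) - real (neighbor_degree_prod T v3)) / N
          \<le> f' v3 - f v3"
        unfolding f_def f'_def using pos[OF P_verts(4)] dec[OF P_verts(4)]
        by (intro quotient_gain) auto
      moreover have "real (neighbor_degree_prod shifted v3) - real (neighbor_degree_prod T v3)
          = real R * ((real (card X) + 1) * 2 ^ card W - (k + real (card X) + 1))"
        unfolding v3_prod v3_prod_shifted k_def by (simp add: algebra_simps)
      ultimately have "c3 \<le> f' v3 - f v3" by (simp add: c3_def)
      moreover have "v2 \<noteq> v3" using P_distinct by simp
      ultimately show ?thesis using 2 v3_notin_X v3_notin_Y by (simp add: g_def)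
    next
      case 3
      \<comment> \<open>For the leaf at \<open>v2\<close> the separating value is
        \<open>D - 1\<close>; its loss is then overestimated with the larger weight
        \<open>1 / N\<close>.\<close>
      have "real (eccentricity T u) \<ge> N + 1" using ecc_ge(2)[OF u] 3 L2_eq diam_ge_5 by (simp add: N_def)
      moreover have "real (eccentricity shifted u) \<le> N + 1"
        using ecc_shifted_le[OF shifted_v3_X[OF 3]] diam_ge_5 by (simp add: N_def)
      ultimately have "- k / (N + 1) \<le> f' u - f u"
        using quotient_change[of "real (eccentricity shifted u)" "N + 1" "real (eccentricity T u)"
            "real (neighbor_degree_prod T u)" "real (neighbor_degree_prod shifted u)"] pos[OF u]
        by (simp add: f_def f'_def X_prod[OF 3] k_def)
      moreover have "k / (N + 1) \<le> k / N" using N by (intro divide_left_mono) (auto simp: k_def)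
      moreover have "g u = - k / N" using 3 v2_notin_X v3_notin_X Y_disjoint by (auto simp: g_def)
      ultimately show ?thesis by simp
    next
      case 4
      have "{v3, u} \<in> edges shifted"
        using 4 v3_nbr_shifted neighbors_iff[OF simple_shifted] by blast
      then have "real (eccentricity shifted u) \<le> N"
        using le_N walk_len_edge[OF simple_shifted] by blast
      then have "(real (neighbor_degree_prod shifted u) - real (neighbor_degree_prod T u)) / N \<le> f' u - f u"
        unfolding f_def f'_def using pos[OF u] dec[OF u] Y_prod[OF 4] by (intro quotient_gain) auto
      moreover have "k \<le> real (neighbor_degree_prod shifted u) - real (neighbor_degree_prod T u)"
        using Y_prod[OF 4] by (simp add: k_def)
      then have "k / N \<le> (real (neighbor_degree_prod shifted u) - real (neighbor_degree_prod T u)) / N"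
        using N by (intro divide_right_mono) auto
      moreover have "g u = k / N" using 4 v2_notin_Y v3_notin_Y Y_disjoint by (auto simp: g_def)
      ultimately show ?thesis by simp
    next
      case 5
      then have "g u = 0"
        using v2_notin_W v3_notin_W Y_disjoint W_X_disjoint by (auto simp: g_def)
      then show ?thesis using gain[OF u] W_prod(1)[OF 5] by simp
    next
      case 6
      then show ?thesis using gain[OF u] other_prod_eq[of u] by (simp add: g_def)
    qed
  qed
  \<comment> \<open>Strictness: the product at \<open>v1\<close> is positive and does not decrease,
    while its eccentricity drops from at least \<open>D - 1\<close> to at most
    \<open>D - 2\<close>.\<close>
  moreover have "f v1 + g v1 < f' v1"
  proof -
    have "g v1 = 0"
      using v1_in_W v2_notin_W v3_notin_W Y_disjoint W_X_disjoint by (auto simp: g_def)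
    moreover have "eccentricity shifted v1 < eccentricity T v1"
      using ecc_shifted_le[OF shifted_v3_W[OF v1_in_W]] ecc_ge(2)[OF P_verts(2)] v1_in_W L2_eq diam_ge_5
      by fastforce
    then have "f v1 < f' v1"
      unfolding f_def f'_def using W_prod[OF v1_in_W] pos[OF P_verts(2)] by (intro frac_less2) auto
    ultimately show ?thesis by simp
  qed
  ultimately have "(\<Sum>u\<in>verts T. f u + g u) < (\<Sum>u\<in>verts T. f' u)"
    using finite_verts P_verts(2) by (intro sum_strict_mono_ex1) auto
  moreover have "(\<Sum>u\<in>verts T. g u) \<ge> 0"
  proof -
    \<comment> \<open>These identities turn the conditional sums over all vertices into multiples of
      \<open>card X\<close> and \<open>card Y\<close>.\<close>
    have "verts T \<inter> X = X" "verts T \<inter> Y = Y" using WXY_verts by auto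
    then have "(\<Sum>u\<in>verts T. g u) = c2 + c3 + card X * (- k / N) + card Y * (k / N)"
      unfolding g_def using finite_verts P_verts
      by (simp add: sum.distrib flip: sum.inter_restrict)
    also have "\<dots> = ((real (card Y) + 1 + k) - (real (card Y) + 1) * 2 ^ card W
        + real R * ((real (card X) + 1) * 2 ^ card W - (k + real (card X) + 1))
        - real (card X) * k + real (card Y) * k) / N"
      by (simp add: c2_def c3_def add_divide_distrib diff_divide_distrib)
    also have "\<dots> \<ge> 0"
      using shift_balance_nonneg[OF card_X R_lower_bound card_Y, of "card W"] N
      unfolding k_def by (intro divide_nonneg_pos) auto
    finally show ?thesis .
  qed
  ultimately show ?thesis by (simp add: xi_ac_def f_def f'_def sum.distrib)
qed

end

theorem theorem12:
  fixes T T' :: "'a sgraph" and P :: "'a list" and W :: "'a set" and n D :: nat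
  assumes "is_tree T"
    and "card (verts T) = n"
    and "has_perfect_matching T"
    and "diam T = D"
    and "D \<ge> 5"
    and "is_diametric_path T P"
    and "W = {w \<in> verts T - {P ! 3}. {P ! 2, w} \<in> edges T \<and> degree T w = 2}"
    and "T' = \<lparr>verts = verts T,
               edges = (edges T - {{P ! 2, w} | w. w \<in> W}) \<union> {{P ! 3, w} | w. w \<in> W}\<rparr>"
  shows "is_tree T' \<and> card (verts T') = n \<and> has_perfect_matching T' \<and> xi_ac T < xi_ac T'"
proof -
  obtain M where M: "is_perfect_matching T M" using assms(3) by (auto simp: has_perfect_matching_def)
  have P: "is_path T P" "length P = diam T + 1" using assms(6) by (auto simp: is_diametric_path_def)
  have "length P \<ge> 6" using P assms(4,5) by simp
  then obtain v0 v1 v2 v3 v4 v5 Q where Q: "P = v0 # v1 # v2 # v3 # v4 # v5 # Q"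
    by (auto simp: numeral_eq_Suc Suc_le_length_iff)
  interpret branch_shift T M v0 v1 v2 v3 v4 v5 Q
    using assms(1) M P unfolding Q by unfold_locales
  have T': "T' = shifted"
    unfolding assms(7,8) shifted_def W_def Q by simp
  show ?thesis
    using tree_shifted matching_shifted xi_ac_shifted assms(2)
    by (auto simp: T' has_perfect_matching_def)
qed

end
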